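(* Let $X_t$ be defined by $F(X_t)-F(0)=Z_t$, where $Z_t=\sigma B_t+\mu t$ with $\sigma>0$ is a Brownian motion with drift and $F$ is strictly increasing. For $y<x$ set $\Delta=F(x)-F(y)$. A) The structure equation $\partial_2\nu_q(x,y^{opt}(x))=r$ for the optimal draw-down level $y^{opt}(x)=x-d^{opt}(x)$ becomes, in terms of $\Delta^{opt}(x)=F(x)-F(y^{opt}(x))$, $$\mu_q^2(\Delta^{opt}(x))+\frac{2\mu}{\sigma^2}\,\mu_q(\Delta^{opt}(x))-\frac{2q}{\sigma^2}=\frac{r}{F'(x)\,F'\big(F^{-1}(F(x)-\Delta^{opt}(x))\big)},$$ for some $r\ge0$. B) If $F$ is furthermore convex, then for fixed $x$ the equation in A) admits exactly one solution $\Delta^{opt}(x)$.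
   Context: $q>0$ is a discount rate. $F$ is a differentiable strictly increasing function with $F'>0$ on an interval containing $0$, mapping onto $\mathbb R$ (so that $X_t=F^{-1}(F(0)+Z_t)$ is well defined). Let $r_+>0>r_-$ be the roots of $\frac{\sigma^2}{2}\rho^2+\mu\rho-q=0$, let $\omega_q(z)=e^{r_+z}-e^{r_-z}$ (the $q$-scale function of $Z$, up to a constant), and $\mu_q(z)=\omega_q'(z)/\omega_q(z)$ for $z>0$ (not to be confused with the drift $\mu$). The two-variable scale function of $X$ is $W_q(x,y)=\omega_q(F(x)-F(y))$ and $$\nu_q(x,y)=\frac{\partial_1W_q(x,y)}{W_q(x,y)}=F'(x)\,\mu_q(F(x)-F(y)),\qquad y<x.$$ $\partial_2$ denotes the derivative in the second variable. The structure equation $\partial_2\nu_q(t,t-d^{opt}(t))=r$ ($r$ constant; $r=0$ corresponds to absence of the area constraint) is the equation that the optimal draw-down function $d^{opt}$ must satisfy on non-bang-bang intervals (those where the optimal slope is not forced to be extremal) in the problem of minimizing $\int_a^b\nu_q(t,t-d(t))dt+\log\nu_q(b,b-d(b))$ over $b$ and over functions $d\ge 0$ with $d'\in[0,1]$, subject to an area constraint $\int_a^bd(t)\,dt\le K$.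
   Formalization: In B, exactly one solution Δ>0 is asserted for each r>0 only; for r=0 the left side is strictly positive for every Δ>0, so there is no finite solution, and instead it is shown that the left side tends to 0 as Δ→∞. *)

theory Defs
  imports "HOL-Probability.Probability"
begin

definition brownian_motion :: "'a measure \<Rightarrow> (real \<Rightarrow> 'a \<Rightarrow> real) \<Rightarrow> bool" where
  "brownian_motion M B \<longleftrightarrow>
     prob_space M \<and>
     (\<forall>t\<ge>0. B t \<in> borel_measurable M) \<and>
     (AE w in M. B 0 w = 0) \<and>
     (\<forall>s t. 0 \<le> s \<and> s < t \<longrightarrow>
        distributed M lborel (\<lambda>w. B t w - B s w)
          (\<lambda>x. ennreal (normal_density 0 (sqrt (t - s)) x))) \<and>
     (\<forall>(n::nat) (ts :: nat \<Rightarrow> real). 0 \<le> ts 0 \<and> strict_mono_on {..n} ts \<longrightarrow>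
        prob_space.indep_vars M (\<lambda>_. borel) (\<lambda>i w. B (ts (Suc i)) w - B (ts i) w) {..<n}) \<and>
     (AE w in M. continuous_on {0..} (\<lambda>t. B t w))"

text \<open>
  The arguments \<open>rp\<close> and \<open>rm\<close> are the positive and the negative root of
  \<open>\<sigma>\<^sup>2/2 * \<rho>\<^sup>2 + \<mu> * \<rho> - q\<close>; the discount rate, drift and volatility enter the scale
  functions only through them.
\<close>

definition omega_q :: "real \<Rightarrow> real \<Rightarrow> real \<Rightarrow> real" where
  "omega_q rp rm z = exp (rp * z) - exp (rm * z)"

definition mu_q :: "real \<Rightarrow> real \<Rightarrow> real \<Rightarrow> real" where
  "mu_q rp rm z = deriv (omega_q rp rm) z / omega_q rp rm z"

definition W_q :: "real \<Rightarrow> real \<Rightarrow> (real \<Rightarrow> real) \<Rightarrow> real \<Rightarrow> real \<Rightarrow> real" where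
  "W_q rp rm F x y = omega_q rp rm (F x - F y)"

definition nu_q :: "real \<Rightarrow> real \<Rightarrow> (real \<Rightarrow> real) \<Rightarrow> real \<Rightarrow> real \<Rightarrow> real" where
  "nu_q rp rm F x y = deriv (\<lambda>u. W_q rp rm F u y) x / W_q rp rm F x y"

text \<open>
  The partial derivative in the second variable is required to exist, so that the equation
  never refers to the unspecified value of \<^const>\<open>deriv\<close> at a point of non-differentiability.
\<close>

definition structure_eq :: "real \<Rightarrow> real \<Rightarrow> (real \<Rightarrow> real) \<Rightarrow> real \<Rightarrow> real \<Rightarrow> real \<Rightarrow> bool" where
  "structure_eq rp rm F r x y \<longleftrightarrow> (nu_q rp rm F x has_real_derivative r) (at y)"

text \<open>\<open>I\<close> is the interval that \<open>F\<close> maps bijectively onto the real line.\<close>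

definition Delta_eq ::
  "real \<Rightarrow> real \<Rightarrow> real \<Rightarrow> real \<Rightarrow> real \<Rightarrow> (real \<Rightarrow> real) \<Rightarrow> real set \<Rightarrow> real \<Rightarrow> real \<Rightarrow> real \<Rightarrow> bool"
where
  "Delta_eq q \<mu> \<sigma> rp rm F I r x \<Delta> \<longleftrightarrow>
     (mu_q rp rm \<Delta>)\<^sup>2 + 2 * \<mu> / \<sigma>\<^sup>2 * mu_q rp rm \<Delta> - 2 * q / \<sigma>\<^sup>2
       = r / (deriv F x * deriv F (inv_into I F (F x - \<Delta>)))"

end

theory Submission
  imports Defs
begin

text \<open>
  With \<open>a = (rp - rm) / 2\<close> one has \<open>mu_q z = (rp + rm) / 2 + a * coth (a * z)\<close>, so by Vieta both the
  quadratic expression in \<^const>\<open>mu_q\<close> and \<open>- mu_q'\<close> equal \<open>(a / sinh (a * z))\<^sup>2\<close>; this gives part A.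
  For part B put \<open>y = F\<^sup>-\<^sup>1 (F x - \<Delta>)\<close>.  The equation then reads \<open>F' x * F' y * (a / sinh (a * \<Delta>))\<^sup>2 = r\<close>;
  its left side is strictly decreasing in \<open>\<Delta>\<close> because convexity makes \<open>F'\<close> nondecreasing, and it
  runs from infinity to 0.  Being the derivative of \<open>nu_q x\<close>, it takes all intermediate values by
  Darboux's theorem, so no continuity of \<open>F'\<close> is needed.
\<close>

section \<open>Closed forms for \<open>mu_q\<close>, its derivative and its quadratic
  expression\<close>

definition mu_decay :: "real \<Rightarrow> real \<Rightarrow> real \<Rightarrow> real" where
  "mu_decay rp rm z = ((rp - rm) / 2 / sinh ((rp - rm) / 2 * z))\<^sup>2"

text \<open>Pulling \<open>exp (s * z)\<close>, with \<open>s\<close> the mean of the two roots, out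
  of both exponentials leaves \<open>2 * sinh (a * z)\<close>. The logarithmic derivative of this
  product is a sum: \<open>s\<close> from the exponential factor and the coth term from the
  other.\<close>

lemma mu_q_eq_coth:
  assumes "rm < rp" "z > 0"
  shows "mu_q rp rm z =
    (rp + rm) / 2 + (rp - rm) / 2 * (cosh ((rp - rm) / 2 * z) / sinh ((rp - rm) / 2 * z))"
proof -
  define a s where "a = (rp - rm) / 2" and "s = (rp + rm) / 2"
  have rp: "rp = s + a" and rm: "rm = s - a"
    by (simp_all add: a_def s_def field_simps)
  have a: "a > 0" using assms(1) by (simp add: a_def)
  have omega: "omega_q rp rm = (\<lambda>z. 2 * exp (s * z) * sinh (a * z))"
    by (rule ext)
       (simp add: omega_q_def rp rm sinh_field_def exp_add exp_diff exp_minus field_simps)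
  have "(omega_q rp rm has_real_derivative
      2 * exp (s * z) * (s * sinh (a * z) + a * cosh (a * z))) (at z)"
    unfolding omega by (auto intro!: derivative_eq_intros simp: algebra_simps)
  then have "mu_q rp rm z =
      (2 * exp (s * z)) * (s * sinh (a * z) + a * cosh (a * z)) / ((2 * exp (s * z)) * sinh (a * z))"
    by (simp add: mu_q_def DERIV_imp_deriv) (simp add: omega)
  also have "\<dots> = (s * sinh (a * z) + a * cosh (a * z)) / sinh (a * z)"
    by (subst mult_divide_mult_cancel_left) simp_all
  also have "\<dots> = s + a * (cosh (a * z) / sinh (a * z))"
    using a assms(2) by (simp add: add_divide_distrib)
  finally show ?thesis by (simp add: a_def s_def)
qed

lemma DERIV_mu_q:
  assumes "rm < rp" "z > 0"
  shows "(mu_q rp rm has_real_derivative - mu_decay rp rm z) (at z)"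
proof -
  define a s where "a = (rp - rm) / 2" and "s = (rp + rm) / 2"
  have a: "a > 0" using assms(1) by (simp add: a_def)
  have sinh: "sinh (a * z) > 0" using a assms(2) by simp
  have "((\<lambda>z. s + a * (cosh (a * z) / sinh (a * z))) has_real_derivative
      a * ((sinh (a * z) * a * sinh (a * z) - cosh (a * z) * (cosh (a * z) * a))
        / (sinh (a * z) * sinh (a * z)))) (at z)"
    using sinh by (auto intro!: derivative_eq_intros simp: algebra_simps)
  also have "a * ((sinh (a * z) * a * sinh (a * z) - cosh (a * z) * (cosh (a * z) * a))
        / (sinh (a * z) * sinh (a * z)))
      = - ((a / sinh (a * z))\<^sup>2)"
  proof -
    have "sinh (a * z) * a * sinh (a * z) - cosh (a * z) * (cosh (a * z) * a) = - a"
      using hyperbolic_pythagoras[of "a * z"] by algebra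
    then show ?thesis by (simp add: power2_eq_square)
  qed
  finally have "((\<lambda>z. s + a * (cosh (a * z) / sinh (a * z))) has_real_derivative - mu_decay rp rm z) (at z)"
    by (simp add: mu_decay_def a_def)
  \<comment> \<open>The closed form is available for positive arguments only, so the two functions
    are compared on a neighbourhood of \<open>z\<close>.\<close>
  moreover have "\<forall>\<^sub>F w in nhds z. mu_q rp rm w = s + a * (cosh (a * w) / sinh (a * w))"
    using eventually_nhds_in_open[of "{0<..}" z] assms
    by (auto elim!: eventually_mono simp: mu_q_eq_coth a_def s_def)
  ultimately show ?thesis
    by (rule DERIV_cong_ev[OF refl _ refl, THEN iffD2, rotated])
qed

text \<open>Completing the square: by Vieta the coefficients are \<open>- 2 * s\<close> and
  \<open>a\<^sup>2 - s\<^sup>2\<close>, so the expression is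
  \<open>(mu_q - s)\<^sup>2 - a\<^sup>2\<close>, that is a^2 * (coth^2 - 1).\<close>

lemma mu_q_quadratic:
  assumes "rm < rp" "\<sigma> > 0" "z > 0"
    and rp: "\<sigma>\<^sup>2 / 2 * rp\<^sup>2 + \<mu> * rp - q = 0"
    and rm: "\<sigma>\<^sup>2 / 2 * rm\<^sup>2 + \<mu> * rm - q = 0"
  shows "(mu_q rp rm z)\<^sup>2 + 2 * \<mu> / \<sigma>\<^sup>2 * mu_q rp rm z - 2 * q / \<sigma>\<^sup>2 = mu_decay rp rm z"
proof -
  \<comment> \<open>Subtracting the two root equations and cancelling \<open>rp - rm\<close> gives
    the sum of the roots; the product then follows from the equation for \<open>rp\<close>.\<close>
  have "(rp - rm) * (\<sigma>\<^sup>2 / 2 * (rp + rm) + \<mu>)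
      = (\<sigma>\<^sup>2 / 2 * rp\<^sup>2 + \<mu> * rp - q) - (\<sigma>\<^sup>2 / 2 * rm\<^sup>2 + \<mu> * rm - q)"
    by (simp add: field_simps power2_eq_square)
  then have "\<sigma>\<^sup>2 / 2 * (rp + rm) + \<mu> = 0"
    using assms(1) unfolding rp rm by simp
  then have mu: "\<mu> = - (\<sigma>\<^sup>2 / 2 * (rp + rm))" by linarith
  have q: "q = - (\<sigma>\<^sup>2 / 2 * (rp * rm))"
    using rp unfolding mu by (simp add: field_simps power2_eq_square)
  define a s where "a = (rp - rm) / 2" and "s = (rp + rm) / 2"
  define m where "m = a * (cosh (a * z) / sinh (a * z))"
  have a: "a > 0" using assms by (simp add: a_def)
  have coeff: "2 * \<mu> / \<sigma>\<^sup>2 = - (2 * s)" "2 * q / \<sigma>\<^sup>2 = a\<^sup>2 - s\<^sup>2"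
    using assms(2) by (simp_all add: mu q a_def s_def field_simps power2_eq_square)
  have mu_q: "mu_q rp rm z = s + m"
    using assms by (simp add: mu_q_eq_coth a_def s_def m_def)
  have "(mu_q rp rm z)\<^sup>2 + 2 * \<mu> / \<sigma>\<^sup>2 * mu_q rp rm z - 2 * q / \<sigma>\<^sup>2 = m\<^sup>2 - a\<^sup>2"
    unfolding coeff mu_q by (simp add: algebra_simps power2_eq_square)
  also have "\<dots> = (a / sinh (a * z))\<^sup>2"
    using a assms(3)
    by (simp add: m_def power_divide power_mult_distrib cosh_square_eq add_divide_distrib distrib_left)
  finally show ?thesis by (simp add: mu_decay_def a_def)
qed

section \<open>Sign, monotonicity and boundary behaviour of \<open>mu_decay\<close>\<close>

lemma mu_decay_pos: "rm < rp \<Longrightarrow> z > 0 \<Longrightarrow> mu_decay rp rm z > 0"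
  by (simp add: mu_decay_def)

lemma mu_decay_strict_antimono:
  assumes "rm < rp" "0 < z" "z < w"
  shows "mu_decay rp rm w < mu_decay rp rm z"
proof -
  have "0 < sinh ((rp - rm) / 2 * z)" "0 < sinh ((rp - rm) / 2 * w)"
    "sinh ((rp - rm) / 2 * z) < sinh ((rp - rm) / 2 * w)"
    using assms by simp_all
  then show ?thesis
    using assms(1) unfolding mu_decay_def
    by (intro power_strict_mono divide_strict_left_mono mult_pos_pos divide_nonneg_pos) auto
qed

lemma mu_decay_tendsto_0:
  assumes "rm < rp"
  shows "(mu_decay rp rm \<longlongrightarrow> 0) at_top"
proof -
  have "filterlim (\<lambda>z. (rp - rm) / 2 * z) at_top at_top"
    using assms by (intro filterlim_tendsto_pos_mult_at_top[OF tendsto_const _ filterlim_ident]) simp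
  then have "filterlim (\<lambda>z. sinh ((rp - rm) / 2 * z)) at_infinity at_top"
    by (intro filterlim_at_top_imp_at_infinity filterlim_compose[OF sinh_real_at_top])
  then have "((\<lambda>z. ((rp - rm) / 2 / sinh ((rp - rm) / 2 * z))\<^sup>2) \<longlongrightarrow> 0\<^sup>2) at_top"
    by (intro tendsto_power tendsto_divide_0[OF tendsto_const])
  then show ?thesis by (simp add: mu_decay_def[abs_def])
qed

lemma mu_decay_at_right_0:
  assumes "rm < rp"
  shows "filterlim (mu_decay rp rm) at_top (at_right 0)"
proof -
  define a where "a = (rp - rm) / 2"
  have a: "a > 0" using assms by (simp add: a_def)
  have "((\<lambda>z. (sinh (a * z))\<^sup>2) \<longlongrightarrow> (sinh (a * 0))\<^sup>2) (at_right 0)"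
    by (intro tendsto_intros)
  then have "((\<lambda>z. (sinh (a * z))\<^sup>2) \<longlongrightarrow> 0) (at_right 0)" by simp
  moreover have "\<forall>\<^sub>F z in at_right 0. (sinh (a * z))\<^sup>2 > 0"
    using eventually_at_right_less[of 0] a by (auto elim!: eventually_mono)
  ultimately have "filterlim (\<lambda>z. a\<^sup>2 / (sinh (a * z))\<^sup>2) at_top (at_right 0)"
    using a by (intro LIM_at_top_divide[OF tendsto_const]) auto
  then show ?thesis by (simp add: mu_decay_def[abs_def] a_def power_divide)
qed

section \<open>The derivative of \<open>nu_q\<close> in its second variable\<close>

lemma DERIV_nu_q:
  assumes "rm < rp" "F differentiable (at x)" "F differentiable (at y)" "F y < F x"
  shows "(nu_q rp rm F x has_real_derivative
    deriv F x * deriv F y * mu_decay rp rm (F x - F y)) (at y)"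
proof -
  have F: "(F has_real_derivative deriv F x) (at x)" "(F has_real_derivative deriv F y) (at y)"
    using assms(2,3) by (simp_all add: DERIV_deriv_iff_real_differentiable)
  have omega: "(omega_q rp rm has_real_derivative deriv (omega_q rp rm) z) (at z)" for z
    unfolding DERIV_deriv_iff_real_differentiable real_differentiable_def omega_q_def[abs_def]
    by (rule exI) (rule derivative_eq_intros refl | simp)+
  \<comment> \<open>This holds for every \<open>y\<close>, not only below \<open>x\<close>: the
    derivative is taken at \<open>x\<close> with \<open>F y\<close> constant, and where
    \<open>F y = F x\<close> both quotients have denominator 0 and hence value 0. An equality of
    functions can therefore be differentiated directly.\<close>
  have "nu_q rp rm F x = (\<lambda>y. deriv F x * mu_q rp rm (F x - F y))"
  proof (rule ext)
    fix y
    have "((\<lambda>u. omega_q rp rm (F u - F y)) has_real_derivative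
        deriv (omega_q rp rm) (F x - F y) * deriv F x) (at x)"
      by (rule DERIV_chain2[OF omega]) (auto intro!: derivative_eq_intros F)
    then show "nu_q rp rm F x y = deriv F x * mu_q rp rm (F x - F y)"
      by (simp add: nu_q_def W_q_def mu_q_def DERIV_imp_deriv)
  qed
  \<comment> \<open>\<open>F y < F x\<close> makes the argument of \<open>mu_q\<close> positive; the
    minus sign of its derivative cancels the one from \<open>F x - F y\<close>.\<close>
  moreover have "((\<lambda>y. mu_q rp rm (F x - F y)) has_real_derivative
      - mu_decay rp rm (F x - F y) * (- deriv F y)) (at y)"
    using assms by (intro DERIV_chain2[OF DERIV_mu_q]) (auto intro!: derivative_eq_intros F)
  from DERIV_cmult[OF this, of "deriv F x"] show ?thesis
    unfolding calculation by (simp add: mult.assoc mult.commute)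
qed

section \<open>Real analysis: intermediate values of derivatives, convexity, and openness of the
  interval\<close>

lemma Darboux:
  fixes f f' :: "real \<Rightarrow> real"
  assumes "a < b" and der: "\<And>x. a \<le> x \<Longrightarrow> x \<le> b \<Longrightarrow> (f has_real_derivative f' x) (at x)"
    and "f' a < k" "k < f' b"
  obtains c where "a < c" "c < b" "f' c = k"
proof -
  \<comment> \<open>Tilting by \<open>k * x\<close> turns the claim into finding a critical point.
    The minimum of \<open>g\<close> over \<open>{a..b}\<close> is one, since \<open>g\<close> has
    negative slope at \<open>a\<close> and positive slope at \<open>b\<close>, which excludes both
    endpoints.\<close>
  define g where "g x = f x - k * x" for x
  have g: "(g has_real_derivative f' x - k) (at x)" if "a \<le> x" "x \<le> b" for x
    unfolding g_def by (auto intro!: derivative_eq_intros der that)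
  then have "continuous_on {a..b} g"
    by (intro continuous_at_imp_continuous_on ballI) (metis DERIV_isCont atLeastAtMost_iff)
  then obtain c where c: "c \<in> {a..b}" and min: "\<And>x. x \<in> {a..b} \<Longrightarrow> g c \<le> g x"
    using continuous_attains_inf[of "{a..b}" g] \<open>a < b\<close> by auto
  have "c \<noteq> a"
  proof
    assume "c = a"
    obtain d where d: "d > 0" "\<forall>h>0. h < d \<longrightarrow> g (a + h) < g a"
      using DERIV_neg_dec_right[OF g[of a]] assms by auto
    \<comment> \<open>Halving \<open>d\<close> makes the step strictly shorter than
      \<open>d\<close>; the cap \<open>b - a\<close> keeps it inside the interval.\<close>
    define h where "h = min (d / 2) (b - a)"
    have "0 < h" "h < d" "a + h \<in> {a..b}" using d(1) \<open>a < b\<close> by (auto simp: h_def)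
    then have "g (a + h) < g c" "g c \<le> g (a + h)" using d(2) min \<open>c = a\<close> by blast+
    then show False by simp
  qed
  moreover have "c \<noteq> b"
  proof
    assume "c = b"
    obtain d where d: "d > 0" "\<forall>h>0. h < d \<longrightarrow> g (b - h) < g b"
      using DERIV_pos_inc_left[OF g[of b]] assms by auto
    define h where "h = min (d / 2) (b - a)"
    have "0 < h" "h < d" "b - h \<in> {a..b}" using d(1) \<open>a < b\<close> by (auto simp: h_def)
    then have "g (b - h) < g c" "g c \<le> g (b - h)" using d(2) min \<open>c = b\<close> by blast+
    then show False by simp
  qed
  ultimately have ab: "a < c" "c < b" using c by auto
  \<comment> \<open>Within this radius every point stays in \<open>{a..b}\<close>, so the minimum
    over the interval is a local one.\<close>
  define e where "e = min (c - a) (b - c)"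
  have "f' c - k = 0"
  proof (rule DERIV_local_min[OF g])
    show "0 < e" "\<forall>y. \<bar>c - y\<bar> < e \<longrightarrow> g c \<le> g y"
      using ab by (auto simp: e_def intro!: min)
  qed (use ab in auto)
  then show thesis using that ab by simp
qed

text \<open>The graph lies above its tangents at \<open>x\<close> and at \<open>y\<close>; adding
  these two inequalities cancels the values of \<open>F\<close> and leaves only the slopes.\<close>

lemma convex_on_deriv_mono:
  fixes F :: "real \<Rightarrow> real"
  assumes "convex_on I F" "open I" and diff: "\<And>z. z \<in> I \<Longrightarrow> F differentiable (at z)"
    and "x \<in> I" "y \<in> I" "x \<le> y"
  shows "deriv F x \<le> deriv F y"
proof (cases "x = y")
  case False
  have tangent: "F v \<ge> F u + deriv F u * (v - u)" if "u \<in> I" "v \<in> I" for u v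
  proof -
    have "(F has_real_derivative deriv F u) (at u within I)"
      using diff[OF that(1)] by (simp add: DERIV_deriv_iff_real_differentiable has_field_derivative_at_within)
    then have "F v - F u \<ge> deriv F u * (v - u)"
      using assms(1,2) that
      by (intro convex_on_imp_above_tangent[of I])
         (auto simp: interior_open convex_connected dest: convex_on_imp_convex)
    then show ?thesis by simp
  qed
  have "(deriv F y - deriv F x) * (y - x) \<ge> 0"
    using tangent[of x y] tangent[of y x] assms(4,5) by (simp add: algebra_simps)
  then show ?thesis
    using False assms(6) by (simp add: zero_le_mult_iff)
qed simp

text \<open>The values \<open>F c - 1\<close> and \<open>F c + 1\<close> are attained, and
  monotonicity places their preimages on either side of \<open>c\<close>, so \<open>I\<close>
  contains none of its endpoints.\<close>

lemma open_interval_if_strict_mono_onto: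
  fixes F :: "real \<Rightarrow> real"
  assumes "is_interval I" "strict_mono_on I F" "F ` I = UNIV"
  shows "open I"
  unfolding open_subopen[of I]
proof
  fix c assume c: "c \<in> I"
  have "F c - 1 \<in> F ` I" "F c + 1 \<in> F ` I" using assms(3) by simp_all
  then obtain a b where ab: "a \<in> I" "b \<in> I" "F a = F c - 1" "F b = F c + 1"
    by (metis imageE)
  have "a < c" "c < b"
    using strict_mono_on_less[OF assms(2) ab(1) c] strict_mono_on_less[OF assms(2) c ab(2)] ab by auto
  moreover have "{a..b} \<subseteq> I"
    using mem_is_interval_1_I[OF assms(1) ab(1,2)] by auto
  ultimately show "\<exists>T. open T \<and> c \<in> T \<and> T \<subseteq> I"
    by (intro exI[of _ "{a<..<b}"] conjI open_greaterThanLessThan)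
       (simp_all add: subset_eq)
qed

text \<open>The optimal level is \<open>x - d x\<close> on a set \<open>T\<close> of points where
  the structure equation is imposed; \<open>d x > 0\<close> puts it strictly below \<open>x\<close>.
  In part B the case r = 0 has no finite solution, but the left side tends to 0, so the solution is
  then read as \<Delta> = infinity.\<close>

theorem lemma15:
  fixes M :: "'a measure" and B X :: "real \<Rightarrow> 'a \<Rightarrow> real"
    and F :: "real \<Rightarrow> real" and I :: "real set"
    and q \<mu> \<sigma> rp rm :: real
  assumes q_pos: "q > 0" and sigma_pos: "\<sigma> > 0"
    and I_interval: "is_interval I" and zero_in_I: "0 \<in> I"
    and F_mono: "strict_mono_on I F"
    and F_diff: "\<forall>x\<in>I. F differentiable (at x)"
    and F_deriv_pos: "\<forall>x\<in>I. deriv F x > 0"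
    and F_onto: "F ` I = UNIV"
    and B_bm: "brownian_motion M B"
    and X_def: "\<forall>t\<ge>0. \<forall>w\<in>space M. X t w \<in> I \<and> F (X t w) - F 0 = \<sigma> * B t w + \<mu> * t"
    and rp_root: "rp > 0" "\<sigma>\<^sup>2 / 2 * rp\<^sup>2 + \<mu> * rp - q = 0"
    and rm_root: "rm < 0" "\<sigma>\<^sup>2 / 2 * rm\<^sup>2 + \<mu> * rm - q = 0"
  shows
    "(\<forall>(T :: real set) (d :: real \<Rightarrow> real) (r :: real).
        T \<subseteq> I \<and> (\<forall>x\<in>T. d x > 0 \<and> x - d x \<in> I) \<longrightarrow>
          ((\<forall>x\<in>T. structure_eq rp rm F r x (x - d x)) \<longleftrightarrow>
           (\<forall>x\<in>T. Delta_eq q \<mu> \<sigma> rp rm F I r x (F x - F (x - d x)))) \<and>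
          (T \<noteq> {} \<and> (\<forall>x\<in>T. structure_eq rp rm F r x (x - d x)) \<longrightarrow> r \<ge> 0))
     \<and>
     (convex_on I F \<longrightarrow>
        (\<forall>x\<in>I.
           (\<forall>r>0. \<exists>!\<Delta>. \<Delta> > 0 \<and> Delta_eq q \<mu> \<sigma> rp rm F I r x \<Delta>) \<and>
           \<not> (\<exists>\<Delta>>0. Delta_eq q \<mu> \<sigma> rp rm F I 0 x \<Delta>) \<and>
           ((\<lambda>\<Delta>. (mu_q rp rm \<Delta>)\<^sup>2 + 2 * \<mu> / \<sigma>\<^sup>2 * mu_q rp rm \<Delta> - 2 * q / \<sigma>\<^sup>2) \<longlongrightarrow> 0) at_top))"
proof -

  \<comment> \<open>Both equations in terms of the level \<open>y\<close>\<close>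
  have rp_rm: "rm < rp" using rp_root rm_root by simp
  have openI: "open I"
    by (rule open_interval_if_strict_mono_onto[OF I_interval F_mono F_onto])
  have less: "F u < F v \<longleftrightarrow> u < v" if "u \<in> I" "v \<in> I" for u v
    using strict_mono_on_less[OF F_mono] that by blast
  have inj: "inj_on F I" using F_mono by (rule strict_mono_on_imp_inj_on)
  \<comment> \<open>Injectivity reduces the \<open>inv_into\<close> term to \<open>y\<close>, and
    positivity of both derivatives of \<open>F\<close> allows clearing the denominator.\<close>
  have Delta_eq_iff: "Delta_eq q \<mu> \<sigma> rp rm F I r x (F x - F y) \<longleftrightarrow>
      deriv F x * deriv F y * mu_decay rp rm (F x - F y) = r"
    if "x \<in> I" "y \<in> I" "y < x" for r x y
  proof -
    have "deriv F x * deriv F y > 0" using F_deriv_pos that by simp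
    moreover have "F x - F y > 0" using less[of y x] that by simp
    ultimately show ?thesis
      using mu_q_quadratic[OF rp_rm sigma_pos _ rp_root(2) rm_root(2), of "F x - F y"] that inj
      by (auto simp: Delta_eq_def field_simps)
  qed
  have der: "(nu_q rp rm F x has_real_derivative
      deriv F x * deriv F y * mu_decay rp rm (F x - F y)) (at y)"
    if "x \<in> I" "y \<in> I" "y < x" for x y
    using DERIV_nu_q[OF rp_rm] F_diff less that by blast
  have structure_eq_iff: "structure_eq rp rm F r x y \<longleftrightarrow>
      deriv F x * deriv F y * mu_decay rp rm (F x - F y) = r"
    if "x \<in> I" "y \<in> I" "y < x" for r x y
    using der[OF that] DERIV_unique unfolding structure_eq_def by blast
  have pos: "deriv F x * deriv F y * mu_decay rp rm (F x - F y) > 0"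
    if "x \<in> I" "y \<in> I" "y < x" for x y
    using F_deriv_pos less[of y x] that by (simp add: mu_decay_pos[OF rp_rm])
  \<comment> \<open>Surjectivity of \<open>F\<close> makes every positive gap come from a level
    below \<open>x\<close>, so solving for \<Delta> amounts to solving for \<open>y\<close>.\<close>
  have level: "\<exists>y\<in>I. y < x \<and> \<Delta> = F x - F y" if "x \<in> I" "\<Delta> > 0" for x \<Delta>
  proof -
    have "F x - \<Delta> \<in> F ` I" using F_onto by simp
    then obtain y where "y \<in> I" "F y = F x - \<Delta>" by (metis imageE)
    then show ?thesis using less[of y x] that by (intro bexI[of _ y]) auto
  qed

  \<comment> \<open>Part A: equivalence of the two equations and the sign of
    \<open>r\<close>\<close>
  have part_A: "((\<forall>x\<in>T. structure_eq rp rm F r x (x - d x)) \<longleftrightarrow>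
           (\<forall>x\<in>T. Delta_eq q \<mu> \<sigma> rp rm F I r x (F x - F (x - d x)))) \<and>
          (T \<noteq> {} \<and> (\<forall>x\<in>T. structure_eq rp rm F r x (x - d x)) \<longrightarrow> r \<ge> 0)"
    if T: "T \<subseteq> I" "\<forall>x\<in>T. d x > 0 \<and> x - d x \<in> I" for T d r
  proof -
    have *: "x \<in> I" "x - d x \<in> I" "x - d x < x" if "x \<in> T" for x
      using T that by auto
    have "structure_eq rp rm F r x (x - d x) \<longleftrightarrow>
        Delta_eq q \<mu> \<sigma> rp rm F I r x (F x - F (x - d x))" if "x \<in> T" for x
      using structure_eq_iff[OF *[OF that]] Delta_eq_iff[OF *[OF that]] by simp
    moreover have "r \<ge> 0" if "x \<in> T" "structure_eq rp rm F r x (x - d x)" for x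
      using structure_eq_iff[OF *[OF that(1)]] pos[OF *[OF that(1)]] that(2) by simp
    ultimately show ?thesis by blast
  qed

  \<comment> \<open>Part B: existence and uniqueness for positive \<open>r\<close>\<close>
  have unique: "\<exists>!\<Delta>. \<Delta> > 0 \<and> Delta_eq q \<mu> \<sigma> rp rm F I r x \<Delta>"
    if conv: "convex_on I F" and x: "x \<in> I" and r: "r > 0" for x r
  proof -
    \<comment> \<open>The left side as a function of the level: raising \<open>y\<close> towards
      \<open>x\<close> shrinks the gap, so \<open>P\<close> increases where the left side decreases
      in \<Delta>.\<close>
    define P where "P y = deriv F x * deriv F y * mu_decay rp rm (F x - F y)" for y
    have mono: "deriv F u \<le> deriv F v" if "u \<in> I" "v \<in> I" "u \<le> v" for u v
      using convex_on_deriv_mono[OF conv openI] F_diff that by blast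
    have Fx: "deriv F x > 0" using F_deriv_pos x by blast
    have P_strict: "P u < P v" if "u \<in> I" "v \<in> I" "u < v" "v < x" for u v
      unfolding P_def
    proof (rule mult_le_less_imp_less)
      show "deriv F x * deriv F u \<le> deriv F x * deriv F v"
        using mono[of u v] that Fx by simp
      show "mu_decay rp rm (F x - F u) < mu_decay rp rm (F x - F v)"
        using that x less by (intro mu_decay_strict_antimono[OF rp_rm]) auto
      show "0 < deriv F x * deriv F u" using F_deriv_pos that Fx by simp
      show "0 \<le> mu_decay rp rm (F x - F u)" by (simp add: mu_decay_def)
    qed
    \<comment> \<open>For gaps below 1 the level lies above \<open>y1\<close>, and convexity bounds
      \<open>deriv F y\<close> below by \<open>deriv F y1\<close>. Hence \<open>P\<close> inherits
      the blow-up of \<open>mu_decay\<close> at 0.\<close>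
    obtain b where b: "b \<in> I" "b < x" "r < P b"
    proof -
      obtain y1 where y1: "y1 \<in> I" "y1 < x" "1 = F x - F y1"
        using level[OF x, of 1] by auto
      define C where "C = deriv F x * deriv F y1"
      have C: "C > 0" using F_deriv_pos y1 Fx by (simp add: C_def)
      have "\<forall>\<^sub>F z in at_right 0. mu_decay rp rm z > r / C"
        using mu_decay_at_right_0[OF rp_rm] by (simp add: filterlim_at_top_dense)
      moreover have "\<forall>\<^sub>F z::real in at_right 0. z \<in> {0<..<1}"
        by (rule eventually_at_right_real) simp
      ultimately have "\<forall>\<^sub>F z in at_right 0. mu_decay rp rm z > r / C \<and> z \<in> {0<..<1}"
        by (rule eventually_conj)
      from eventually_happens[OF this]
      obtain z where z: "mu_decay rp rm z > r / C" "0 < z" "z < 1" by auto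
      obtain y where y: "y \<in> I" "y < x" "z = F x - F y"
        using level[OF x z(2)] by auto
      have "y1 < y" using less[of y1 y] y y1 z by auto
      then have "C \<le> deriv F x * deriv F y"
        using mono[of y1 y] y y1 Fx by (simp add: C_def)
      then have "C * mu_decay rp rm z \<le> P y"
        unfolding P_def y(3) by (rule mult_right_mono) (simp add: mu_decay_def)
      moreover have "r < C * mu_decay rp rm z" using z(1) C by (simp add: field_simps)
      ultimately show thesis using that y by simp
    qed
    \<comment> \<open>Below \<open>x\<close>, convexity bounds \<open>deriv F y\<close> above by
      \<open>deriv F x\<close>, so \<open>P\<close> inherits the decay of \<open>mu_decay\<close>. A
      gap larger than \<open>F x - F b\<close> puts the level under \<open>b\<close>.\<close>
    obtain a where a: "a \<in> I" "a < b" "P a < r"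
    proof -
      define C where "C = deriv F x * deriv F x"
      have C: "C > 0" using Fx by (simp add: C_def)
      have "\<forall>\<^sub>F z in at_top. mu_decay rp rm z < r / C"
        using order_tendstoD(2)[OF mu_decay_tendsto_0[OF rp_rm]] r C by simp
      moreover have "\<forall>\<^sub>F z in at_top. z > F x - F b" by (rule eventually_gt_at_top)
      ultimately have "\<forall>\<^sub>F z in at_top. mu_decay rp rm z < r / C \<and> z > F x - F b"
        by (rule eventually_conj)
      from eventually_happens[OF this]
      obtain z where z: "mu_decay rp rm z < r / C" "z > F x - F b" by auto
      have "F b < F x" using less b x by blast
      then obtain y where y: "y \<in> I" "y < x" "z = F x - F y"
        using level[OF x, of z] z by auto
      have "deriv F x * deriv F y \<le> C"
        using mono[of y x] y x Fx by (simp add: C_def)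
      then have "P y \<le> C * mu_decay rp rm z"
        unfolding P_def y(3) by (rule mult_right_mono) (simp add: mu_decay_def)
      moreover have "C * mu_decay rp rm z < r" using z(1) C by (simp add: field_simps)
      moreover have "y < b" using less[of y b] y b z by auto
      ultimately show thesis using that y by simp
    qed
    have "(nu_q rp rm F x has_real_derivative P y) (at y)" if "a \<le> y" "y \<le> b" for y
      using der[OF x, of y] mem_is_interval_1_I[OF I_interval a(1) b(1) that] that b(2)
      by (simp add: P_def)
    then obtain c where c: "a < c" "c < b" "P c = r"
      using Darboux[OF a(2), of "nu_q rp rm F x" P r] a(3) b(3) by blast
    have cI: "c \<in> I" "c < x"
      using mem_is_interval_1_I[OF I_interval a(1) b(1), of c] c b by auto
    show ?thesis
    proof (rule ex1I[of _ "F x - F c"])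
      show "F x - F c > 0 \<and> Delta_eq q \<mu> \<sigma> rp rm F I r x (F x - F c)"
        using c(3) cI x less by (simp add: Delta_eq_iff P_def)
    next
      fix \<Delta> assume \<Delta>: "\<Delta> > 0 \<and> Delta_eq q \<mu> \<sigma> rp rm F I r x \<Delta>"
      then obtain y where y: "y \<in> I" "y < x" "\<Delta> = F x - F y" using level x by blast
      then have "P y = P c" using \<Delta> c(3) x by (simp add: Delta_eq_iff P_def)
      then have "y = c" using P_strict[of y c] P_strict[of c y] y cI by (cases y c rule: linorder_cases) auto
      then show "\<Delta> = F x - F c" using y by simp
    qed
  qed

  \<comment> \<open>The degenerate case r = 0\<close>
  have none: "\<not> (\<exists>\<Delta>>0. Delta_eq q \<mu> \<sigma> rp rm F I 0 x \<Delta>)" if x: "x \<in> I" for x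
  proof
    assume "\<exists>\<Delta>>0. Delta_eq q \<mu> \<sigma> rp rm F I 0 x \<Delta>"
    then obtain y where "y \<in> I" "y < x" "Delta_eq q \<mu> \<sigma> rp rm F I 0 x (F x - F y)"
      using level[OF x] by blast
    then show False using Delta_eq_iff[OF x, of y 0] pos[OF x, of y] by auto
  qed

  \<comment> \<open>The quadratic identity holds for positive arguments, hence eventually, which is
    enough to transfer the limit of \<open>mu_decay\<close>.\<close>
  have "\<forall>\<^sub>F z in at_top. mu_decay rp rm z =
      (mu_q rp rm z)\<^sup>2 + 2 * \<mu> / \<sigma>\<^sup>2 * mu_q rp rm z - 2 * q / \<sigma>\<^sup>2"
    using eventually_gt_at_top[of 0]
    by (rule eventually_mono)
       (rule mu_q_quadratic[OF rp_rm sigma_pos _ rp_root(2) rm_root(2), symmetric])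
  then have lim: "((\<lambda>\<Delta>. (mu_q rp rm \<Delta>)\<^sup>2 + 2 * \<mu> / \<sigma>\<^sup>2 * mu_q rp rm \<Delta> - 2 * q / \<sigma>\<^sup>2) \<longlongrightarrow> 0) at_top"
    by (rule Lim_transform_eventually[OF mu_decay_tendsto_0[OF rp_rm]])
  show ?thesis
  proof (rule conjI; intro allI impI ballI)
    fix T d r assume T: "T \<subseteq> I \<and> (\<forall>x\<in>T. d x > 0 \<and> x - d x \<in> I)"
    show "((\<forall>x\<in>T. structure_eq rp rm F r x (x - d x)) \<longleftrightarrow>
           (\<forall>x\<in>T. Delta_eq q \<mu> \<sigma> rp rm F I r x (F x - F (x - d x)))) \<and>
          (T \<noteq> {} \<and> (\<forall>x\<in>T. structure_eq rp rm F r x (x - d x)) \<longrightarrow> r \<ge> 0)"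
      by (rule part_A[OF conjunct1[OF T] conjunct2[OF T]])
  next
    fix x assume "convex_on I F" "x \<in> I"
    then show "(\<forall>r>0. \<exists>!\<Delta>. \<Delta> > 0 \<and> Delta_eq q \<mu> \<sigma> rp rm F I r x \<Delta>) \<and>
        \<not> (\<exists>\<Delta>>0. Delta_eq q \<mu> \<sigma> rp rm F I 0 x \<Delta>) \<and>
        ((\<lambda>\<Delta>. (mu_q rp rm \<Delta>)\<^sup>2 + 2 * \<mu> / \<sigma>\<^sup>2 * mu_q rp rm \<Delta> - 2 * q / \<sigma>\<^sup>2) \<longlongrightarrow> 0) at_top"
      by (intro conjI allI impI unique none lim)
  qed
qed

end
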